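(* Let $q\in\mathbb{C}$ with $0<|q|<1$, let $r,s\ge1$ be integers with $s\le r\le s+1$, and let $\alpha_1,\dots,\alpha_r,\beta_1,\dots,\beta_s,z,w\in\mathbb{C}$ with $\alpha_1\ne0$, $\alpha_1\notin\{q^{k}:k\ge1\}$, $\beta_1\notin\{q^k:k\in\mathbb{Z}\}$ and $\beta_j\notin\{q^{-k}:k\ge0\}$ for $2\le j\le s$. Suppose $|\beta_{1}/\alpha_{1}|<|w|<1$, and $|z|<|w|$ if $r=s+1$. Then $$\sum_{m=-\infty}^{\infty}\frac{(\alpha_{1};q)_{m}}{(\beta_{1};q)_{m}}\;{}_{r}\phi_{s}\left(\begin{matrix}\alpha_{1}q^{m},\alpha_2,\dots,\alpha_{r}\\ \beta_{1}q^{m},\beta_2,\dots,\beta_{s}\end{matrix}\;\Big|\;q,z\right)w^{m}$$ $$=\frac{\left(q/(\alpha_{1}w),\alpha_{1}w,q,\beta_{1}/\alpha_{1};q\right)_{\infty}}{\left(\beta_{1},q/\alpha_{1},w,\beta_{1}/(\alpha_{1}w);q\right)_{\infty}}\;{}_{r-1}\phi_{s-1}\left(\begin{matrix}\alpha_{2},\dots,\alpha_{r}\\ \beta_{2},\dots,\beta_{s}\end{matrix}\;\Big|\;q,\frac{z}{w}\right).$$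
   Context: Notation: $(a;q)_\infty=\prod_{k\ge0}(1-aq^k)$, $(a;q)_n=(a;q)_\infty/(aq^n;q)_\infty$ for every integer $n$ (positive or negative; for $n<0$ this means $(a;q)_n=1/\prod_{k=1}^{-n}(1-aq^{-k})$), and $(a_1,\dots,a_j;q)_n=\prod_i(a_i;q)_n$ (also for $n=\infty$). The basic hypergeometric series is $${}_r\phi_s\left(\begin{matrix}a_1,\dots,a_r\\ b_1,\dots,b_s\end{matrix}\;\Big|\;q,x\right)=\sum_{n=0}^\infty\frac{(a_1,\dots,a_r;q)_n}{(q,b_1,\dots,b_s;q)_n}\left((-1)^nq^{n(n-1)/2}\right)^{s+1-r}x^n$$ (empty parameter lists are allowed). *)

theory Defs
  imports "HOL-Analysis.Analysis"
begin

definition qpoch_inf :: "complex \<Rightarrow> complex \<Rightarrow> complex" where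
  "qpoch_inf a q = (\<Prod>k. 1 - a * q ^ k)"

(* The quotient (a;q)_inf / (a q^n;q)_inf is of the form 0/0 when a and a q^n both lie in
   {q^0, q^(-1), ...} (for example for a terminating series).  The finite products below are
   its usual interpretation; lemma qpoch_eq_quotient gives the quotient form. *)
definition qpoch :: "complex \<Rightarrow> complex \<Rightarrow> int \<Rightarrow> complex" where
  "qpoch a q n =
     (if n \<ge> 0 then \<Prod>k<nat n. 1 - a * q ^ k
      else 1 / (\<Prod>k=1..nat (- n). 1 - a * q powi (- int k)))"

definition qpochs_inf :: "complex list \<Rightarrow> complex \<Rightarrow> complex" where
  "qpochs_inf as q = (\<Prod>a\<leftarrow>as. qpoch_inf a q)"

definition qpochs :: "complex list \<Rightarrow> complex \<Rightarrow> int \<Rightarrow> complex" where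
  "qpochs as q n = (\<Prod>a\<leftarrow>as. qpoch a q n)"

(* The exponent s + 1 - r is an integer that may be negative, hence powi. *)
definition qhyp :: "complex list \<Rightarrow> complex list \<Rightarrow> complex \<Rightarrow> complex \<Rightarrow> complex" where
  "qhyp as bs q x =
     (\<Sum>n. qpochs as q (int n) / qpochs (q # bs) q (int n)
           * ((-1) ^ n * q ^ (n * (n - 1) div 2)) powi (int (length bs) + 1 - int (length as))
           * x ^ n)"

lemma qpoch_inf_convergent:
  assumes "norm q < 1"
  shows   "convergent_prod (\<lambda>k. 1 - a * q ^ k :: complex)"
proof -
  have "summable (\<lambda>k. norm a * norm q ^ k)"
    using assms by (intro summable_mult summable_geometric) auto
  hence "summable (\<lambda>k. norm ((1 - a * q ^ k) - 1))"
    by (simp add: norm_mult norm_power)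
  thus ?thesis
    using abs_convergent_prod_conv_summable abs_convergent_prod_imp_convergent_prod by blast
qed

lemma qpoch_inf_LIMSEQ:
  assumes "norm q < 1"
  shows   "(\<lambda>n. \<Prod>k<n. 1 - a * q ^ k) \<longlonglongrightarrow> qpoch_inf a q"
  using convergent_prod_LIMSEQ[OF qpoch_inf_convergent[OF assms, of a]]
  unfolding qpoch_inf_def LIMSEQ_lessThan_iff_atMost .

lemma qpoch_inf_shift:
  assumes "norm q < 1"
  shows   "qpoch_inf a q = (\<Prod>k<N. 1 - a * q ^ k) * qpoch_inf (a * q ^ N) q"
proof (rule LIMSEQ_unique)
  show "(\<lambda>n. \<Prod>k<n + N. 1 - a * q ^ k) \<longlonglongrightarrow> qpoch_inf a q"
    using qpoch_inf_LIMSEQ[OF assms, of a] by (rule LIMSEQ_ignore_initial_segment)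
  have split: "(\<Prod>k<n + N. 1 - a * q ^ k) =
        (\<Prod>k<N. 1 - a * q ^ k) * (\<Prod>k<n. 1 - a * q ^ N * q ^ k)" for n
    by (induction n) (simp_all add: power_add mult_ac)
  show "(\<lambda>n. \<Prod>k<n + N. 1 - a * q ^ k)
          \<longlonglongrightarrow> (\<Prod>k<N. 1 - a * q ^ k) * qpoch_inf (a * q ^ N) q"
    unfolding split by (intro tendsto_mult tendsto_const qpoch_inf_LIMSEQ assms)
qed

lemma qpoch_eq_quotient:
  assumes "q \<noteq> 0" "norm q < 1" "qpoch_inf (a * q powi n) q \<noteq> 0"
  shows   "qpoch a q n = qpoch_inf a q / qpoch_inf (a * q powi n) q"
proof (cases "n \<ge> 0")
  case True
  thus ?thesis
    using qpoch_inf_shift[OF assms(2), of a "nat n"] assms(3)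
    by (simp add: qpoch_def power_int_def)
next
  case False
  define N where "N = nat (- n)"
  have n: "n = - int N"
    using False by (simp add: N_def)
  have "a * q powi n * q ^ N = a"
    using assms(1) by (simp add: n power_int_minus)
  hence *: "qpoch_inf (a * q powi n) q =
          (\<Prod>k<N. 1 - a * q powi n * q ^ k) * qpoch_inf a q"
    using qpoch_inf_shift[OF assms(2), of "a * q powi n" N] by (simp only:)
  have "(\<Prod>k<N. 1 - a * q powi n * q ^ k) = (\<Prod>k=1..N. 1 - a * q powi (- int k))"
  proof (rule prod.reindex_bij_witness[of _ "\<lambda>k. N - k" "\<lambda>k. N - k"])
    fix k assume k: "k \<in> {..<N}"
    have "q powi (- int (N - k)) = q powi (n + int k)"
      using k by (intro arg_cong[where f = "(powi) q"]) (auto simp: n)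
    also have "\<dots> = q powi n * q ^ k"
      using assms(1) by (simp add: power_int_add)
    finally show "1 - a * q powi (- int (N - k)) = 1 - a * q powi n * q ^ k"
      by (simp add: mult.assoc)
  qed auto
  thus ?thesis
    using * assms(3) False by (simp add: qpoch_def N_def)
qed

end

theory Submission
  imports Defs
begin

text \<open>
  Write \<open>A m = (a; q)_m / (b; q)_m * w^m\<close> with \<open>a = \<alpha> 1\<close> and \<open>b = \<beta> 1\<close>.  Since
  \<open>(a; q)_m * (a q^m; q)_n = (a; q)_(m + n)\<close>, expanding the hypergeometric series in the left-hand
  side gives the double series of \<open>A (m + n) * c n\<close> over integers \<open>m\<close> and naturals \<open>n\<close>, where
  \<open>c n\<close> is the \<open>n\<close>-th term of the series on the right, with argument \<open>z / w\<close>: the shift from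
  \<open>w^m\<close> to \<open>w^(m + n)\<close> turns \<open>z^n\<close> into \<open>(z / w)^n\<close>.  The double series converges absolutely, and
  a shift of \<open>m\<close> by \<open>n\<close> makes it factor into the sum of \<open>A\<close> times the sum of \<open>c\<close>
  (\<open>has_sum_bilateral_convolution\<close>).  The sum of \<open>A\<close> is Ramanujan's bilateral sum
  (\<open>ramanujan_1psi1\<close>), whose value is the quotient of infinite products.

  For Ramanujan's sum, multiply by \<open>(b; q)_inf\<close> to get the series
  \<open>F b = (\<Sum>m. (a; q)_m * (b q^m; q)_inf * w^m)\<close>, whose terms are entire in \<open>b\<close>.
  Comparing it with its shift by one gives \<open>(1 - b / (a w)) * F b = (1 - b / a) * F (b q)\<close>
  (\<open>psi_sum_contiguous\<close>).  As \<open>F\<close> is continuous at \<open>0\<close>, iteration expresses \<open>F b\<close> by \<open>F 0\<close>.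
  To find \<open>F 0\<close>, take \<open>b = q^(N + 1)\<close> with \<open>N\<close> so large that \<open>b\<close> is in the disc of convergence:
  all terms with \<open>m < - N\<close> vanish, and what is left is summed by the \<open>q\<close>-binomial theorem
  (\<open>q_binomial\<close>).  The \<open>q\<close>-binomial theorem has the same kind of proof, with the dilation
  \<open>w \<mapsto> w q\<close> in place of \<open>b \<mapsto> b q\<close>.
\<close>

section \<open>Shifted factorials\<close>

text \<open>
  For negative \<open>m\<close> the factor \<open>1 - a * q powi m\<close> is the last one of the product in the denominator,
  so it cancels only if it is nonzero; this is what the assumption on \<open>a\<close> ensures.
\<close>

lemma qpoch_plus_one:
  assumes "q \<noteq> 0" "\<And>k::nat. k \<ge> 1 \<Longrightarrow> a \<noteq> q ^ k"
  shows   "qpoch a q (m + 1) = qpoch a q m * (1 - a * q powi m)"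
proof (cases "m \<ge> 0")
  case True
  then have "nat (m + 1) = Suc (nat m)" by simp
  with True show ?thesis by (simp add: qpoch_def power_int_def)
next
  case False
  define n where "n = nat (- m - 1)"
  have m: "m = - int (Suc n)" using False by (simp add: n_def)
  have "a \<noteq> q ^ Suc n" using assms(2)[of "Suc n"] by simp
  \<comment> \<open>Here \<open>q powi m\<close> is the inverse of \<open>q ^ Suc n\<close>.\<close>
  then have ne: "1 - a * q powi m \<noteq> 0"
    using assms(1) unfolding m power_int_minus power_int_of_nat by (simp add: field_simps)
  show ?thesis
  proof (cases n)
    case 0
    then show ?thesis using ne by (simp add: m qpoch_def)
  next
    case (Suc k)
    have "qpoch a q (m + 1) = 1 / (\<Prod>k=1..n. 1 - a * q powi (- int k))"
    proof -
      have "nat (- (m + 1)) = n" "\<not> m + 1 \<ge> 0" using Suc by (simp_all add: m)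
      then show ?thesis unfolding qpoch_def by (simp only: if_False)
    qed
    moreover have "qpoch a q m = 1 / ((\<Prod>k=1..n. 1 - a * q powi (- int k)) * (1 - a * q powi m))"
    proof -
      have "nat (- m) = Suc n" "\<not> m \<ge> 0" by (simp_all add: m)
      then have "qpoch a q m = 1 / (\<Prod>k=1..Suc n. 1 - a * q powi (- int k))"
        unfolding qpoch_def by (simp only: if_False)
      then show ?thesis unfolding m by simp
    qed
    ultimately show ?thesis using ne by simp
  qed
qed

lemma qpoch_0 [simp]: "qpoch a q 0 = 1"
  by (simp add: qpoch_def)

lemma qpoch_nat_Suc: "qpoch a q (int (Suc n)) = qpoch a q (int n) * (1 - a * q ^ n)"
proof -
  have "nat (1 + int n) = Suc n" by simp
  then show ?thesis by (simp add: qpoch_def)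
qed

lemma qpoch_add:
  assumes "q \<noteq> 0" "\<And>k::nat. k \<ge> 1 \<Longrightarrow> a \<noteq> q ^ k"
  shows   "qpoch a q (m + int n) = qpoch a q m * qpoch (a * q powi m) q (int n)"
proof (induction n)
  case (Suc n)
  have "qpoch a q (m + int (Suc n)) = qpoch a q (m + int n) * (1 - a * q powi (m + int n))"
    using qpoch_plus_one[OF assms, of "m + int n"] by (simp add: add_ac)
  also have "\<dots> = qpoch a q m * qpoch (a * q powi m) q (int (Suc n))"
    using assms(1) unfolding Suc.IH qpoch_nat_Suc by (simp add: power_int_add mult_ac)
  finally show ?case .
qed simp

text \<open>
  A bound that is uniform in \<open>n\<close> and tends to \<open>0\<close> with \<open>b\<close>: it yields both the boundedness of the
  finite and infinite products and the continuity of the infinite product at \<open>b = 0\<close>.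
\<close>

lemma norm_prod_qpoch_minus_one_le:
  fixes b q :: complex
  assumes "norm q < 1"
  shows   "norm ((\<Prod>k<n. 1 - b * q ^ k) - 1) \<le> exp (norm b / (1 - norm q)) - 1"
proof -
  have "norm ((\<Prod>k<n. 1 + (- (b * q ^ k))) - 1) \<le> (\<Prod>k<n. 1 + norm (- (b * q ^ k))) - 1"
    by (rule norm_prod_minus1_le_prod_minus1)
  also have "(\<Prod>k<n. 1 + norm (- (b * q ^ k))) \<le> exp (\<Sum>k<n. norm (- (b * q ^ k)))"
    by (rule prod_le_exp_sum) auto
  also have "(\<Sum>k<n. norm (- (b * q ^ k))) = norm b * (\<Sum>k<n. norm q ^ k)"
    by (simp add: norm_mult norm_power sum_distrib_left)
  also have "(\<Sum>k<n. norm q ^ k) \<le> (\<Sum>k. norm q ^ k)"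
    using assms by (intro sum_le_suminf summable_geometric) auto
  also have "(\<Sum>k. norm q ^ k) = 1 / (1 - norm q)"
    using assms by (intro suminf_geometric) auto
  finally show ?thesis by (simp add: mult_left_mono)
qed

lemma norm_qpoch_nat_le:
  assumes "norm q < 1"
  shows   "norm (qpoch a q (int n)) \<le> exp (norm a / (1 - norm q))"
  using norm_prod_qpoch_minus_one_le[OF assms, where b = a and n = n]
    norm_triangle_sub[of "\<Prod>k<n. 1 - a * q ^ k" 1]
  by (simp add: qpoch_def)

lemma norm_qpoch_inf_minus_one_le:
  assumes "norm q < 1"
  shows   "norm (qpoch_inf b q - 1) \<le> exp (norm b / (1 - norm q)) - 1"
proof (rule LIMSEQ_le_const2)
  show "(\<lambda>n. norm ((\<Prod>k<n. 1 - b * q ^ k) - 1)) \<longlonglongrightarrow> norm (qpoch_inf b q - 1)"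
    by (intro tendsto_intros qpoch_inf_LIMSEQ assms)
qed (use norm_prod_qpoch_minus_one_le[OF assms] in auto)

lemma norm_qpoch_inf_le:
  assumes "norm q < 1" "norm b \<le> R"
  shows   "norm (qpoch_inf b q) \<le> exp (R / (1 - norm q))"
proof -
  have "norm (qpoch_inf b q) \<le> exp (norm b / (1 - norm q))"
    using norm_qpoch_inf_minus_one_le[OF assms(1), of b] norm_triangle_sub[of "qpoch_inf b q" 1]
    by simp
  also have "\<dots> \<le> exp (R / (1 - norm q))"
    using assms by (simp add: divide_right_mono)
  finally show ?thesis .
qed

lemma tendsto_qpoch_inf_zero:
  assumes "norm q < 1" "(f \<longlongrightarrow> 0) G"
  shows   "((\<lambda>x. qpoch_inf (f x) q) \<longlongrightarrow> 1) G"
proof (rule LIM_zero_cancel, rule Lim_null_comparison)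
  show "\<forall>\<^sub>F x in G. norm (qpoch_inf (f x) q - 1) \<le> exp (norm (f x) / (1 - norm q)) - 1"
    using norm_qpoch_inf_minus_one_le[OF assms(1)] by simp
  have "((\<lambda>x. exp (norm (f x) / (1 - norm q)) - 1) \<longlongrightarrow> exp (norm (0::complex) / (1 - norm q)) - 1) G"
    using assms by (intro tendsto_intros) auto
  then show "((\<lambda>x. exp (norm (f x) / (1 - norm q)) - 1) \<longlongrightarrow> 0) G" by simp
qed

lemma qpoch_inf_nonzero:
  assumes "norm q < 1" "\<And>k. a * q ^ k \<noteq> 1"
  shows   "qpoch_inf a q \<noteq> 0"
  unfolding qpoch_inf_def
proof (rule prodinf_nonzero)
  show "1 - a * q ^ k \<noteq> 0" for k using assms(2)[of k] by simp
qed (rule qpoch_inf_convergent[OF assms(1)])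

lemma mult_power_neq_one:
  fixes a q :: complex
  assumes "norm q < 1" "norm a < 1"
  shows   "a * q ^ k \<noteq> 1"
proof
  assume "a * q ^ k = 1"
  then have "norm a * norm q ^ k = 1" by (metis norm_mult norm_power norm_one)
  moreover have "norm a * norm q ^ k \<le> norm a"
    using assms by (intro mult_right_le_one_le power_le_one) auto
  ultimately show False using assms by simp
qed

lemma qpoch_inf_nonzero_of_norm_less_one:
  assumes "norm q < 1" "norm a < 1"
  shows   "qpoch_inf a q \<noteq> 0"
  by (rule qpoch_inf_nonzero[OF assms(1) mult_power_neq_one[OF assms]])

lemma qpoch_inf_step:
  assumes "norm q < 1"
  shows   "qpoch_inf a q = (1 - a) * qpoch_inf (a * q) q"
  using qpoch_inf_shift[OF assms, of a 1] by simp

lemma qpoch_inf_power_int_step: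
  assumes "q \<noteq> 0" "norm q < 1"
  shows   "qpoch_inf (b * q powi m) q = (1 - b * q powi m) * qpoch_inf (b * q powi (m + 1)) q"
  using qpoch_inf_step[OF assms(2), of "b * q powi m"] assms(1)
  by (simp add: power_int_add mult_ac)

lemma LIMSEQ_mult_power_0:
  fixes b q :: complex
  assumes "norm q < 1"
  shows   "(\<lambda>N. b * q ^ N) \<longlonglongrightarrow> 0"
  using tendsto_mult_right_zero[OF LIMSEQ_power_zero[OF assms]] by blast

section \<open>Convergence of series\<close>

text \<open>
  Here the ratio \<open>g\<close> is given by a multiplicative recurrence and not as a quotient, so the criterion
  covers series some of whose terms vanish.
\<close>

lemma summable_norm_ratio_limit:
  fixes f g :: "nat \<Rightarrow> 'a :: real_normed_field"
  assumes "\<And>n. f (Suc n) = f n * g n" "g \<longlonglongrightarrow> L" "norm L < 1"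
  shows   "summable (\<lambda>n. norm (f n))"
proof -
  obtain c where c: "norm L < c" "c < 1" using dense[OF assms(3)] by blast
  have "\<forall>\<^sub>F n in sequentially. norm (g n) < c"
    using order_tendstoD(2)[OF tendsto_norm[OF assms(2)] c(1)] .
  then obtain N where N: "\<And>n. n \<ge> N \<Longrightarrow> norm (g n) < c"
    by (auto simp: eventually_at_top_linorder)
  show ?thesis
  proof (rule summable_ratio_test[OF c(2)])
    fix n assume "n \<ge> N"
    then have "norm (f n) * norm (g n) \<le> norm (f n) * c"
      using N[of n] by (intro mult_left_mono) auto
    then show "norm (norm (f (Suc n))) \<le> c * norm (norm (f n))"
      by (simp add: assms(1) norm_mult mult_ac)
  qed
qed

lemma summable_on_int_of_halves:
  fixes f :: "int \<Rightarrow> real"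
  assumes "\<And>m. f m \<ge> 0" "summable (\<lambda>n. f (int n))" "summable (\<lambda>n. f (- int n))"
  shows   "f summable_on UNIV"
proof -
  have U: "(UNIV :: int set) = range int \<union> range (\<lambda>n. - int n)"
    by (auto simp: image_iff) (metis int_cases2)
  have 1: "f summable_on range int"
    using assms by (subst summable_on_reindex) (auto simp: o_def summable_on_UNIV_nonneg_real_iff)
  have 2: "f summable_on range (\<lambda>n. - int n)"
    using assms by (subst summable_on_reindex)
      (auto simp: o_def summable_on_UNIV_nonneg_real_iff inj_on_def)
  show ?thesis unfolding U by (rule summable_on_union[OF 1 2])
qed

lemma qpochs_Suc: "qpochs as q (int (Suc n)) = qpochs as q (int n) * (\<Prod>a\<leftarrow>as. 1 - a * q ^ n)"
  by (induction as) (simp_all add: qpochs_def qpoch_nat_Suc mult_ac del: of_nat_Suc)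

lemma qpochs_quotient_Cons:
  "qpochs (x # as) q n / qpochs (p # y # bs) q n
    = qpoch x q n / qpoch y q n * (qpochs as q n / qpochs (p # bs) q n)"
  unfolding times_divide_times_eq by (simp add: qpochs_def mult_ac)

lemma LIMSEQ_prod_list_one_minus:
  fixes q :: complex
  assumes "norm q < 1"
  shows   "(\<lambda>n. \<Prod>a\<leftarrow>as. 1 - a * q ^ n) \<longlonglongrightarrow> 1"
proof (induction as)
  case (Cons a as)
  have "(\<lambda>n. (1 - a * q ^ n) * (\<Prod>a\<leftarrow>as. 1 - a * q ^ n)) \<longlonglongrightarrow> (1 - 0) * 1"
    by (intro tendsto_mult tendsto_diff tendsto_const LIMSEQ_mult_power_0 assms Cons)
  then show ?case by simp
qed simp

text \<open>
  The ratio of consecutive terms is a quotient of products of factors \<open>1 - a * q ^ n\<close>, which tend to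
  \<open>1\<close>, times \<open>(- (q ^ n)) ^ e * x\<close> with \<open>e = length bs + 1 - length as\<close>.
\<close>

lemma summable_norm_qhyp_terms:
  assumes "norm q < 1" "length as \<le> length bs + 1"
    and "length as = length bs + 1 \<Longrightarrow> norm x < 1"
  shows "summable (\<lambda>n. norm (qpochs as q (int n) / qpochs (q # bs) q (int n)
           * ((-1) ^ n * q ^ (n * (n - 1) div 2)) powi (int (length bs) + 1 - int (length as))
           * x ^ n))"
proof -
  define e where "e = length bs + 1 - length as"
  have e: "int (length bs) + 1 - int (length as) = int e" using assms(2) by (simp add: e_def)
  define g where "g n = (\<Prod>a\<leftarrow>as. 1 - a * q ^ n) / (\<Prod>b\<leftarrow>q # bs. 1 - b * q ^ n) * (- (q ^ n)) ^ e * x"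
    for n
  have tri: "Suc n * n div 2 = n * (n - 1) div 2 + n" for n :: nat
    by (cases n) (simp_all)
  have neg: "(\<lambda>n. - (q ^ n)) \<longlonglongrightarrow> - 0"
    by (intro tendsto_intros LIMSEQ_power_zero assms(1))
  show ?thesis unfolding e power_int_of_nat
  proof (rule summable_norm_ratio_limit[where g = g])
    show "g \<longlonglongrightarrow> (1 / 1) * (- 0) ^ e * x" unfolding g_def
      by (intro tendsto_mult tendsto_divide tendsto_const tendsto_power[OF neg]
          LIMSEQ_prod_list_one_minus assms(1)) auto
    \<comment> \<open>The quadratic powers of \<open>q\<close> make the limit vanish unless they are absent (\<open>e = 0\<close>).\<close>
    show "norm ((1 / 1) * (- 0) ^ e * x) < 1"
    proof (cases "e = 0")
      case True
      then have "length as = length bs + 1" using assms(2) by (simp add: e_def)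
      then show ?thesis using True assms(3) by simp
    next
      case False
      then show ?thesis by (simp add: power_0_left)
    qed
    fix n
    have pow: "((-1) ^ Suc n * q ^ (n * (n - 1) div 2 + n)) ^ e
        = ((-1) ^ n * q ^ (n * (n - 1) div 2)) ^ e * (- (q ^ n)) ^ e"
      unfolding power_mult_distrib[symmetric] by (simp add: power_add mult_ac)
    show "qpochs as q (int (Suc n)) / qpochs (q # bs) q (int (Suc n))
           * ((-1) ^ Suc n * q ^ (Suc n * (Suc n - 1) div 2)) ^ e * x ^ Suc n
        = qpochs as q (int n) / qpochs (q # bs) q (int n)
           * ((-1) ^ n * q ^ (n * (n - 1) div 2)) ^ e * x ^ n * g n"
      unfolding qpochs_Suc diff_Suc_1 tri pow g_def by (simp add: mult_ac)
  qed
qed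

text \<open>
  Because \<open>m\<close> runs over a group, \<open>(m, n) \<mapsto> (m + n, n)\<close> permutes the index set and carries the
  double series into a product of two absolutely convergent series.
\<close>

lemma has_sum_bilateral_convolution:
  fixes A :: "int \<Rightarrow> complex" and c :: "nat \<Rightarrow> complex"
  assumes "(A has_sum S) UNIV" "summable (\<lambda>n. norm (c n))"
  shows   "((\<lambda>m. \<Sum>n. A (m + int n) * c n) has_sum (S * suminf c)) UNIV"
proof -
  have c: "(c has_sum suminf c) UNIV"
    by (rule norm_summable_imp_has_sum[OF assms(2)])
      (use assms(2) in \<open>auto dest: summable_norm_cancel\<close>)
  have A_abs: "(\<lambda>m. norm (A m)) summable_on UNIV"
    using assms(1) has_sum_imp_summable summable_on_iff_abs_summable_on_complex by blast
  have c_abs: "(\<lambda>n. norm (c n)) summable_on UNIV"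
    using assms(2) by (simp add: summable_on_UNIV_nonneg_real_iff)
  have "(\<lambda>p. norm (case p of (m, n) \<Rightarrow> A m * c n)) summable_on (UNIV \<times> UNIV)"
  proof (rule summable_on_SigmaI)
    show "((\<lambda>n. norm (case (m, n) of (m, n) \<Rightarrow> A m * c n))
        has_sum (norm (A m) * (\<Sum>\<^sub>\<infinity>n. norm (c n)))) UNIV" for m
      using has_sum_cmult_right[OF has_sum_infsum[OF c_abs], of "norm (A m)"] by (simp add: norm_mult)
    show "(\<lambda>m. norm (A m) * (\<Sum>\<^sub>\<infinity>n. norm (c n))) summable_on UNIV"
      by (rule summable_on_cmult_left[OF A_abs])
  qed simp
  then have "(\<lambda>(m, n). A m * c n) summable_on (UNIV \<times> UNIV)"
    by (rule abs_summable_summable)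
  then have "((\<lambda>(m, n). A m * c n) has_sum (S * suminf c)) (UNIV \<times> UNIV)"
    by (intro has_sum_SigmaI[where g = "\<lambda>m. A m * suminf c"])
      (auto intro: has_sum_cmult_right has_sum_cmult_left c assms(1))
  also have "?this \<longleftrightarrow> ((\<lambda>(m, n). A (m + int n) * c n) has_sum (S * suminf c)) (UNIV \<times> UNIV)"
    by (rule has_sum_reindex_bij_witness[where i = "\<lambda>(m, n). (m + int n, n)"
          and j = "\<lambda>(m, n). (m - int n, n)"]) auto
  finally have D: "((\<lambda>(m, n). A (m + int n) * c n) has_sum (S * suminf c)) (UNIV \<times> UNIV)" .
  have "((\<lambda>n. A (m + int n) * c n) has_sum (\<Sum>n. A (m + int n) * c n)) UNIV" for m
  proof -
    have "(\<lambda>n. A (m + int n) * c n) summable_on UNIV"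
      using summable_on_SigmaD1[OF has_sum_imp_summable[OF D], of m] by simp
    then show ?thesis
      using has_sum_imp_sums has_sum_infsum sums_unique by metis
  qed
  then show ?thesis
    by (intro has_sum_Sigma'[OF D]) auto
qed

section \<open>The $q$-binomial theorem\<close>

lemma q_power_neq_one:
  assumes "norm (q :: complex) < 1"
  shows   "q * q ^ n \<noteq> 1"
  using mult_power_neq_one[OF assms assms] .

text \<open>
  The sum \<open>H w\<close> satisfies \<open>(1 - w) * H w = (1 - a * w) * H (w * q)\<close>, which is the recurrence of
  the coefficients in disguise.  Iteration moves the argument to \<open>0\<close>, where \<open>H\<close> is continuous
  with value \<open>1\<close>.
\<close>

lemma q_binomial:
  assumes "norm q < 1" "norm w < 1"
  shows   "(\<lambda>n. qpoch a q (int n) / qpoch q q (int n) * w ^ n) sums (qpoch_inf (a * w) q / qpoch_inf w q)"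
    and   "summable (\<lambda>n. norm (qpoch a q (int n) / qpoch q q (int n) * w ^ n))"
proof -
  define h where "h n = qpoch a q (int n) / qpoch q q (int n)" for n
  have abs: "summable (\<lambda>n. norm (h n * x ^ n))" if "norm x < 1" for x
    using summable_norm_qhyp_terms[of q "[a]" "[]" x] assms(1) that by (simp add: qpochs_def h_def)
  then show "summable (\<lambda>n. norm (qpoch a q (int n) / qpoch q q (int n) * w ^ n))"
    using assms(2) by (simp add: h_def)
  define H where "H x = (\<Sum>n. h n * x ^ n)" for x
  have H: "(\<lambda>n. h n * x ^ n) sums H x" if "norm x < 1" for x
    unfolding H_def by (rule summable_sums[OF summable_norm_cancel[OF abs[OF that]]])
  have h_Suc: "h (Suc n) * (1 - q ^ Suc n) = h n * (1 - a * q ^ n)" for n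
    using q_power_neq_one[OF assms(1), of n] unfolding h_def qpoch_nat_Suc by simp
  have step: "H x * (1 - x) = (1 - a * x) * H (x * q)" if x: "norm x < 1" for x
  proof -
    have "norm (x * q) \<le> norm x" using assms(1) by (simp add: norm_mult mult_left_le)
    then have xq: "norm (x * q) < 1" using x by simp
    have "(\<lambda>n. x * (h n * x ^ n - a * (h n * (x * q) ^ n))) sums (x * (H x - a * H (x * q)))"
      by (intro sums_mult sums_diff H x xq)
    also have "(\<lambda>n. x * (h n * x ^ n - a * (h n * (x * q) ^ n)))
        = (\<lambda>n. h n * (1 - a * q ^ n) * x ^ Suc n)"
      by (simp add: algebra_simps power_mult_distrib)
    also have "\<dots> = (\<lambda>n. h (Suc n) * x ^ Suc n - h (Suc n) * (x * q) ^ Suc n)"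
      unfolding h_Suc[symmetric] by (simp add: algebra_simps power_mult_distrib)
    finally have "(\<lambda>n. h n * x ^ n - h n * (x * q) ^ n) sums (x * (H x - a * H (x * q)))"
      by (subst (asm) sums_Suc_iff) simp
    moreover have "(\<lambda>n. h n * x ^ n - h n * (x * q) ^ n) sums (H x - H (x * q))"
      by (intro sums_diff H x xq)
    ultimately have "H x - H (x * q) = x * (H x - a * H (x * q))"
      by (rule sums_unique2[rotated])
    then show ?thesis by (simp add: algebra_simps)
  qed
  have wq: "norm (w * q ^ N) < 1" for N
  proof -
    have "norm (w * q ^ N) \<le> norm w"
      using assms by (simp add: norm_mult norm_power mult_left_le power_le_one)
    then show ?thesis using assms(2) by simp
  qed
  have iter: "H w * (\<Prod>k<N. 1 - w * q ^ k) = (\<Prod>k<N. 1 - a * w * q ^ k) * H (w * q ^ N)" for N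
  proof (induction N)
    case (Suc N)
    have "H w * (\<Prod>k<Suc N. 1 - w * q ^ k)
        = (\<Prod>k<N. 1 - a * w * q ^ k) * (H (w * q ^ N) * (1 - w * q ^ N))"
      using Suc.IH by simp
    also have "\<dots> = (\<Prod>k<Suc N. 1 - a * w * q ^ k) * H (w * q ^ Suc N)"
      unfolding step[OF wq[of N]] by (simp add: mult_ac)
    finally show ?case .
  qed simp
  have "summable (\<lambda>n. h n * (1 / 2) ^ n)"
    by (rule summable_norm_cancel[OF abs]) (simp add: norm_divide)
  then have "isCont H 0"
    unfolding H_def[abs_def] by (rule isCont_powser) simp
  then have "(\<lambda>N. H (w * q ^ N)) \<longlonglongrightarrow> H 0"
    by (rule isCont_tendsto_compose) (rule LIMSEQ_mult_power_0[OF assms(1)])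
  moreover have "H 0 = 1"
    unfolding H_def powser_zero by (simp add: h_def)
  ultimately have "(\<lambda>N. H w * (\<Prod>k<N. 1 - w * q ^ k)) \<longlonglongrightarrow> qpoch_inf (a * w) q * 1"
    unfolding iter by (intro tendsto_mult qpoch_inf_LIMSEQ assms) simp
  moreover have "(\<lambda>N. H w * (\<Prod>k<N. 1 - w * q ^ k)) \<longlonglongrightarrow> H w * qpoch_inf w q"
    by (intro tendsto_mult qpoch_inf_LIMSEQ assms tendsto_const)
  ultimately have "H w * qpoch_inf w q = qpoch_inf (a * w) q"
    using LIMSEQ_unique by fastforce
  then have "H w = qpoch_inf (a * w) q / qpoch_inf w q"
    using qpoch_inf_nonzero_of_norm_less_one[OF assms] by (simp add: field_simps)
  then show "(\<lambda>n. qpoch a q (int n) / qpoch q q (int n) * w ^ n) sums (qpoch_inf (a * w) q / qpoch_inf w q)"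
    using H[OF assms(2)] by (simp add: h_def)
qed

section \<open>Ramanujan's bilateral sum\<close>

text \<open>
  This is the summand of Ramanujan's series multiplied by \<open>(b; q)_inf\<close>.  It is defined for every
  \<open>b\<close>; in particular \<open>b = 0\<close> and \<open>b = q ^ Suc N\<close> are admitted, which are the values at which the
  series is evaluated below.
\<close>

definition psi_term :: "complex \<Rightarrow> complex \<Rightarrow> complex \<Rightarrow> complex \<Rightarrow> int \<Rightarrow> complex" where
  "psi_term a q w b m = qpoch a q m * qpoch_inf (b * q powi m) q * w powi m"

context
  fixes a q w :: complex
  assumes q: "q \<noteq> 0" "norm q < 1"
    and a: "a \<noteq> 0" "\<And>k::nat. k \<ge> 1 \<Longrightarrow> a \<noteq> q ^ k"
    and w: "w \<noteq> 0" "norm w < 1"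
begin

text \<open>
  Both neighbours \<open>psi_term a q w b m\<close> and \<open>psi_term a q w b (m + 1)\<close> are multiples of the same
  term with parameter \<open>b * q\<close>.  Eliminating \<open>q powi m\<close> between the two relations
  yields the functional equation of the sum; eliminating the common term yields the
  recurrence in \<open>m\<close> that is used to bound the terms.
\<close>

lemma psi_term_q_shift: "psi_term a q w b m = (1 - b * q powi m) * psi_term a q w (b * q) m"
  using qpoch_inf_power_int_step[OF q, of b m] q(1)
  by (simp add: psi_term_def power_int_add mult_ac)

lemma psi_term_plus_one: "psi_term a q w b (m + 1) = (1 - a * q powi m) * w * psi_term a q w (b * q) m"
  using qpoch_plus_one[OF q(1) a(2), of m] q(1) w(1)
  by (simp add: psi_term_def power_int_add mult_ac)

text \<open>
  The terms have a summable majorant that is uniform for \<open>b\<close> in a disc.  Towards \<open>+\<infinity>\<close> it is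
  geometric with ratio \<open>norm w\<close>; towards \<open>-\<infinity>\<close> the ratio of consecutive terms is
  \<open>(q ^ k - b) / ((q ^ k - a) * w)\<close>, and the bound \<open>g\<close> for it tends to \<open>R / norm (a * w) < 1\<close>.
\<close>

lemma psi_term_dominated:
  assumes R: "0 \<le> R" "R < norm (a * w)"
  obtains M where "M summable_on UNIV" "\<And>m b. norm b \<le> R \<Longrightarrow> norm (psi_term a q w b m) \<le> M m"
proof -
  define K where "K = exp (R / (1 - norm q))"
  define C where "C = exp (norm a / (1 - norm q))"
  define g where "g k = (R + norm q ^ Suc k) / (norm (a - q ^ Suc k) * norm w)" for k
  define M where "M m = (if m \<ge> 0 then C * K * norm w ^ nat m else K * (\<Prod>k<nat (- m). g k))" for m
  have K: "norm (qpoch_inf b q) \<le> K" if "norm b \<le> R" for b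
    unfolding K_def by (rule norm_qpoch_inf_le[OF q(2) that])
  have pos: "0 < C" "0 < K" by (simp_all add: C_def K_def)
  have g: "g k \<ge> 0" for k using R by (simp add: g_def)
  have nz: "norm (a - q ^ Suc k) * norm w > 0" for k
    using a(2)[of "Suc k"] w(1) by simp
  have nonneg: "norm (psi_term a q w b (int n)) \<le> C * K * norm w ^ n" if b: "norm b \<le> R" for b n
  proof -
    have "norm (b * q ^ n) \<le> norm b"
      using q(2) by (simp add: norm_mult norm_power mult_left_le power_le_one)
    then have "norm (qpoch_inf (b * q ^ n) q) \<le> K" using K b by simp
    then show ?thesis
      using norm_qpoch_nat_le[OF q(2), of a n] pos
      by (auto simp: psi_term_def norm_mult norm_power C_def intro!: mult_mono)
  qed
  have neg: "norm (psi_term a q w b (- int n)) \<le> K * (\<Prod>k<n. g k)" if b: "norm b \<le> R" for b n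
  proof (induction n)
    case 0
    then show ?case using K[OF b] by (simp add: psi_term_def)
  next
    case (Suc n)
    define m where "m = - int (Suc n)"
    have qm: "q ^ Suc n * q powi m = 1"
      unfolding m_def power_int_minus power_int_of_nat using q(1) by (simp add: field_simps)
    have "psi_term a q w b (m + 1) * (1 - b * q powi m) = psi_term a q w b m * ((1 - a * q powi m) * w)"
      using psi_term_q_shift[of b m] psi_term_plus_one[of b m] by (simp add: mult_ac)
    then have "psi_term a q w b (m + 1) * (q ^ Suc n * (1 - b * q powi m))
        = psi_term a q w b m * (q ^ Suc n * (1 - a * q powi m) * w)"
      by (metis (no_types, lifting) mult.assoc mult.left_commute)
    moreover have "q ^ Suc n * (1 - x * q powi m) = q ^ Suc n - x" for x
      using qm by (simp add: right_diff_distrib mult.left_commute[of _ x])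
    moreover have "m + 1 = - int n" by (simp add: m_def)
    ultimately have "psi_term a q w b (- int n) * (q ^ Suc n - b)
        = psi_term a q w b m * ((q ^ Suc n - a) * w)" by (simp only:)
    then have eq: "norm (psi_term a q w b m) * (norm (a - q ^ Suc n) * norm w)
        = norm (psi_term a q w b (- int n)) * norm (q ^ Suc n - b)"
      unfolding norm_mult[symmetric] norm_minus_commute[of a] by (simp only: norm_mult)
    have "norm (q ^ Suc n - b) \<le> R + norm q ^ Suc n"
      using norm_triangle_ineq4[of "q ^ Suc n" b] b unfolding norm_power by linarith
    then have "norm (psi_term a q w b m) * (norm (a - q ^ Suc n) * norm w)
        \<le> norm (psi_term a q w b (- int n)) * (R + norm q ^ Suc n)"
      unfolding eq by (intro mult_left_mono) auto
    then have "norm (psi_term a q w b m) \<le> norm (psi_term a q w b (- int n)) * g n"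
      using nz[of n] unfolding g_def by (simp add: times_divide_eq_right pos_le_divide_eq del: power_Suc)
    also have "\<dots> \<le> (K * (\<Prod>k<n. g k)) * g n"
      using Suc g by (intro mult_right_mono) auto
    finally show ?case by (simp add: m_def mult_ac)
  qed
  have lim: "g \<longlonglongrightarrow> (R + 0) / (norm (a - 0) * norm w)"
    unfolding g_def using a(1) w(1) q(2)
    by (intro tendsto_intros LIMSEQ_Suc LIMSEQ_power_zero) auto
  have "summable (\<lambda>n. norm (\<Prod>k<n. g k))"
    by (rule summable_norm_ratio_limit[OF _ lim]) (use R nz[of 0] a(1) w(1) in \<open>auto simp: norm_mult\<close>)
  then have S: "summable (\<lambda>n. K * (\<Prod>k<n. g k))"
    by (rule summable_mult[OF summable_norm_cancel])
  have S0: "summable (\<lambda>n. C * K * norm w ^ n)"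
    using w by (intro summable_mult summable_geometric) auto
  show ?thesis
  proof
    show "M summable_on UNIV"
    proof (rule summable_on_int_of_halves)
      show "M m \<ge> 0" for m using pos g by (auto simp: M_def intro!: mult_nonneg_nonneg prod_nonneg)
      show "summable (\<lambda>n. M (int n))" using S0 by (simp add: M_def)
      show "summable (\<lambda>n. M (- int n))"
      proof -
        have eq: "M (- int (Suc n)) = K * (\<Prod>k<Suc n. g k)" for n
        proof -
          have "nat (- (- int (Suc n))) = Suc n" "\<not> - int (Suc n) \<ge> 0" by simp_all
          then show ?thesis unfolding M_def by (simp only: if_False)
        qed
        show ?thesis
          by (subst summable_Suc_iff[symmetric], unfold eq, subst summable_Suc_iff) (rule S)
      qed
    qed
  next
    fix m and b :: complex assume b: "norm b \<le> R"
    show "norm (psi_term a q w b m) \<le> M m"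
      using nonneg[OF b, of "nat m"] neg[OF b, of "nat (- m)"] by (auto simp: M_def)
  qed
qed

definition psi_sum :: "complex \<Rightarrow> complex" where
  "psi_sum b = (\<Sum>\<^sub>\<infinity>m. psi_term a q w b m)"

lemma has_sum_psi_sum:
  assumes "norm b < norm (a * w)"
  shows   "(psi_term a q w b has_sum psi_sum b) UNIV"
proof -
  obtain M where M: "M summable_on UNIV" "\<And>m b'. norm b' \<le> norm b \<Longrightarrow> norm (psi_term a q w b' m) \<le> M m"
    using psi_term_dominated[of "norm b"] assms by auto
  have "(\<lambda>m. norm (psi_term a q w b m)) summable_on UNIV"
    by (rule Infinite_Sum.abs_summable_on_comparison_test'[OF M(1)]) (use M(2) in auto)
  then show ?thesis
    unfolding psi_sum_def by (rule has_sum_infsum[OF abs_summable_summable])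
qed

text \<open>
  By the uniform majorant, the finite partial sums converge uniformly near \<open>b = 0\<close>, so the limit
  may be taken term by term.
\<close>

lemma tendsto_psi_sum_zero:
  assumes "X \<longlonglongrightarrow> 0"
  shows   "(\<lambda>n. psi_sum (X n)) \<longlonglongrightarrow> psi_sum 0"
proof -
  define R where "R = norm (a * w) / 2"
  have R: "0 < R" "R < norm (a * w)" using a w by (auto simp: R_def)
  obtain M where M: "M summable_on UNIV" "\<And>m b. norm b \<le> R \<Longrightarrow> norm (psi_term a q w b m) \<le> M m"
    using psi_term_dominated[of R] R by auto
  have unif: "uniform_limit (cball 0 R) (\<lambda>T b. \<Sum>m\<in>T. psi_term a q w b m) psi_sum
      (finite_subsets_at_top UNIV)"
    by (rule Weierstrass_m_test_general'[OF _ _ M(1)]) (use M(2) R in \<open>auto intro: has_sum_psi_sum\<close>)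
  have term_lim: "((\<lambda>b. psi_term a q w b m) \<longlongrightarrow> psi_term a q w 0 m) (at 0 within cball 0 R)" for m
  proof -
    have "((\<lambda>b. qpoch_inf (b * q powi m) q) \<longlongrightarrow> 1) (at 0 within cball 0 R)"
      by (rule tendsto_qpoch_inf_zero[OF q(2)]) (rule tendsto_mult_left_zero, rule tendsto_ident_at)
    moreover have "qpoch_inf 0 q = 1" by (simp add: qpoch_inf_def)
    ultimately show ?thesis unfolding psi_term_def by (intro tendsto_mult tendsto_const) simp
  qed
  have "(psi_sum \<longlongrightarrow> psi_sum 0) (at 0 within cball 0 R)"
  proof (rule swap_uniform_limit)
    show "\<forall>\<^sub>F T in finite_subsets_at_top UNIV. ((\<lambda>b. \<Sum>m\<in>T. psi_term a q w b m) \<longlongrightarrow>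
        (\<Sum>m\<in>T. psi_term a q w 0 m)) (at 0 within cball 0 R)"
      by (intro always_eventually allI tendsto_sum term_lim)
    show "((\<lambda>T. \<Sum>m\<in>T. psi_term a q w 0 m) \<longlongrightarrow> psi_sum 0) (finite_subsets_at_top UNIV)"
      using has_sum_psi_sum[of 0] a(1) w(1) unfolding has_sum_def by (simp add: norm_mult)
  qed (use unif in auto)
  then have "(psi_sum \<longlongrightarrow> psi_sum 0) (at 0)"
    using R by (subst (asm) at_within_interior) (auto simp: interior_cball)
  then have "isCont psi_sum 0" by (simp add: isCont_def)
  then show ?thesis using assms by (rule isCont_tendsto_compose)
qed

lemma psi_sum_contiguous:
  assumes "norm b < norm (a * w)"
  shows   "psi_sum b * (1 - b / (a * w)) = (1 - b / a) * psi_sum (b * q)"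
proof -
  have "norm (b * q) \<le> norm b" using q(2) by (simp add: norm_mult mult_left_le)
  then have bq: "norm (b * q) < norm (a * w)" using assms by simp
  have "bij_betw (\<lambda>m. m + 1) UNIV (UNIV :: int set)"
    by (rule bij_betwI[where g = "\<lambda>m. m - 1"]) auto
  then have shift: "((\<lambda>m. psi_term a q w b (m + 1)) has_sum psi_sum b) UNIV"
    using has_sum_psi_sum[OF assms] by (subst has_sum_reindex_bij_betw)
  \<comment> \<open>This combination of a term and its successor is free of \<open>q powi m\<close>.\<close>
  have "((\<lambda>m. a * w * psi_term a q w b m + (- b) * psi_term a q w b (m + 1))
      has_sum (a * w * psi_sum b + (- b) * psi_sum b)) UNIV"
    by (intro has_sum_add has_sum_cmult_right has_sum_psi_sum assms shift)
  also have "(\<lambda>m. a * w * psi_term a q w b m + (- b) * psi_term a q w b (m + 1))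
      = (\<lambda>m. (a * w - b * w) * psi_term a q w (b * q) m)"
  proof
    show "a * w * psi_term a q w b m + (- b) * psi_term a q w b (m + 1)
        = (a * w - b * w) * psi_term a q w (b * q) m" for m
      unfolding psi_term_q_shift[of b m] psi_term_plus_one[of b m] by (simp add: algebra_simps)
  qed
  finally have "a * w * psi_sum b + (- b) * psi_sum b = (a * w - b * w) * psi_sum (b * q)"
    using has_sum_unique has_sum_cmult_right[OF has_sum_psi_sum[OF bq]] by blast
  then have "(a * w - b) * psi_sum b = (a * w - b * w) * psi_sum (b * q)"
    by (simp add: algebra_simps)
  moreover have "a * w - b = a * w * (1 - b / (a * w))" "a * w - b * w = a * w * (1 - b / a)"
    using a(1) w(1) by (simp_all add: field_simps)
  ultimately have "a * w * (psi_sum b * (1 - b / (a * w))) = a * w * ((1 - b / a) * psi_sum (b * q))"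
    by (simp only: mult_ac)
  then show ?thesis using a(1) w(1) by simp
qed

lemma psi_sum_eq_psi_sum_zero:
  assumes "norm b < norm (a * w)"
  shows   "psi_sum b * qpoch_inf (b / (a * w)) q = qpoch_inf (b / a) q * psi_sum 0"
proof -
  have iter: "psi_sum b * (\<Prod>k<N. 1 - b / (a * w) * q ^ k)
      = (\<Prod>k<N. 1 - b / a * q ^ k) * psi_sum (b * q ^ N)" for N
  proof (induction N)
    case (Suc N)
    have "norm (b * q ^ N) \<le> norm b"
      using q(2) by (simp add: norm_mult norm_power mult_left_le power_le_one)
    then have "norm (b * q ^ N) < norm (a * w)" using assms by simp
    from psi_sum_contiguous[OF this]
    have step: "psi_sum (b * q ^ N) * (1 - b / (a * w) * q ^ N)
        = (1 - b / a * q ^ N) * psi_sum (b * q ^ Suc N)" by (simp add: mult_ac)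
    have "psi_sum b * (\<Prod>k<Suc N. 1 - b / (a * w) * q ^ k)
        = (\<Prod>k<N. 1 - b / a * q ^ k) * (psi_sum (b * q ^ N) * (1 - b / (a * w) * q ^ N))"
      using Suc.IH by simp
    then show ?case unfolding step by simp
  qed simp
  have "(\<lambda>N. psi_sum b * (\<Prod>k<N. 1 - b / (a * w) * q ^ k)) \<longlonglongrightarrow> qpoch_inf (b / a) q * psi_sum 0"
    unfolding iter
    by (intro tendsto_mult qpoch_inf_LIMSEQ q(2) tendsto_psi_sum_zero LIMSEQ_mult_power_0)
  moreover have "(\<lambda>N. psi_sum b * (\<Prod>k<N. 1 - b / (a * w) * q ^ k))
      \<longlonglongrightarrow> psi_sum b * qpoch_inf (b / (a * w)) q"
    by (intro tendsto_mult qpoch_inf_LIMSEQ q(2) tendsto_const)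
  ultimately show ?thesis using LIMSEQ_unique by blast
qed

text \<open>
  For \<open>m < - N\<close> the product \<open>(q^(N + 1 + m); q)_inf\<close> contains the factor \<open>1 - 1\<close>.  With
  \<open>m = k - N\<close>, the remaining terms form the \<open>q\<close>-binomial series in \<open>w\<close> with parameter
  \<open>a * q powi (- N)\<close>.
\<close>

lemma psi_sum_q_power:
  assumes "norm (q ^ Suc N) < norm (a * w)"
  shows   "psi_sum (q ^ Suc N) * qpoch_inf w q
      = qpoch_inf q q * (qpoch a q (- int N) * w powi (- int N) * qpoch_inf (a * w * q powi (- int N)) q)"
proof -
  define d where "d = qpoch a q (- int N) * w powi (- int N) * qpoch_inf q q"
  define a' where "a' = a * q powi (- int N)"
  have vanish: "psi_term a q w (q ^ Suc N) m = 0" if "m \<notin> range (\<lambda>k. int k - int N)" for m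
  proof -
    have "m < - int N"
    proof (rule ccontr)
      assume "\<not> m < - int N"
      then have "m = int (nat (m + int N)) - int N" by simp
      then show False using that by blast
    qed
    define j where "j = nat (- m) - Suc N"
    have m: "m = - int (Suc N + j)" using \<open>m < - int N\<close> by (simp add: j_def)
    have "q ^ Suc N * q powi m * q ^ j = 1"
      unfolding m power_int_minus power_int_of_nat power_add using q(1) by (simp add: field_simps)
    then have "(\<Prod>k<Suc j. 1 - q ^ Suc N * q powi m * q ^ k) = 0" by auto
    then have "qpoch_inf (q ^ Suc N * q powi m) q = 0"
      using qpoch_inf_shift[OF q(2), of "q ^ Suc N * q powi m" "Suc j"] by simp
    then show ?thesis by (simp add: psi_term_def)
  qed
  have support: "psi_term a q w (q ^ Suc N) (int k - int N)
      = d * (qpoch a' q (int k) / qpoch q q (int k) * w ^ k)" for k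
  proof -
    have "qpoch_inf (q * q ^ k) q \<noteq> 0"
      by (rule qpoch_inf_nonzero[OF q(2)])
        (use q_power_neq_one[OF q(2)] in \<open>simp add: mult.assoc power_add[symmetric]\<close>)
    moreover have shift: "qpoch_inf q q = qpoch q q (int k) * qpoch_inf (q * q ^ k) q"
      using qpoch_inf_shift[OF q(2), of q k] by (simp add: qpoch_def)
    moreover have "qpoch q q (int k) \<noteq> 0"
      using q_power_neq_one[OF q(2)] by (auto simp: qpoch_def)
    ultimately have 1: "qpoch_inf (q * q ^ k) q = qpoch_inf q q / qpoch q q (int k)" by simp
    have 2: "q ^ Suc N * q powi (int k - int N) = q * q ^ k"
      using q(1) by (simp add: power_int_diff)
    have 3: "qpoch a q (int k - int N) = qpoch a q (- int N) * qpoch a' q (int k)"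
      using qpoch_add[OF q(1) a(2), of "- int N" k] by (simp add: a'_def add_ac)
    have 4: "w powi (int k - int N) = w powi (- int N) * w ^ k"
      using w(1) by (simp add: power_int_diff power_int_minus field_simps)
    show ?thesis unfolding psi_term_def 1 2 3 4 d_def by simp
  qed
  have "((\<lambda>k. d * (qpoch a' q (int k) / qpoch q q (int k) * w ^ k))
      has_sum (d * (qpoch_inf (a' * w) q / qpoch_inf w q))) UNIV"
    by (intro has_sum_cmult_right norm_summable_imp_has_sum q_binomial q(2) w(2))
  then have "((psi_term a q w (q ^ Suc N) \<circ> (\<lambda>k. int k - int N))
      has_sum (d * (qpoch_inf (a' * w) q / qpoch_inf w q))) UNIV"
    unfolding o_def support .
  then have "(psi_term a q w (q ^ Suc N) has_sum (d * (qpoch_inf (a' * w) q / qpoch_inf w q)))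
      (range (\<lambda>k. int k - int N))"
    by (subst has_sum_reindex) (auto simp: inj_on_def)
  then have "(psi_term a q w (q ^ Suc N) has_sum (d * (qpoch_inf (a' * w) q / qpoch_inf w q))) UNIV"
    by (rule has_sum_cong_neutral[THEN iffD1, rotated -1]) (use vanish in auto)
  then have "psi_sum (q ^ Suc N) = d * (qpoch_inf (a' * w) q / qpoch_inf w q)"
    using has_sum_psi_sum[OF assms] has_sum_unique by blast
  then show ?thesis
    using qpoch_inf_nonzero_of_norm_less_one[OF q(2) w(2)] by (simp add: d_def a'_def mult_ac)
qed

text \<open>
  Rewriting each \<open>1 - x * q powi (- k)\<close> as \<open>- x * q powi (- k) * (1 - q ^ k / x)\<close>, for \<open>x = a\<close>
  and for \<open>x = a * w\<close>, turns negative powers of \<open>q\<close> into positive ones; in the quotient of the two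
  the prefactors leave \<open>w ^ N\<close>, which \<open>w powi (- N)\<close> cancels.
\<close>

lemma qpoch_reflection_quotient:
  "qpoch a q (- int N) * w powi (- int N) * qpoch_inf (a * w * q powi (- int N)) q * qpoch (q / a) q (int N)
    = qpoch (q / (a * w)) q (int N) * qpoch_inf (a * w) q"
proof (induction N)
  case (Suc N)
  define m where "m = - int (Suc N)"
  have m1: "m + 1 = - int N" by (simp add: m_def)
  have Q: "q powi m = 1 / (q * q ^ N)"
    unfolding m_def power_int_minus power_int_of_nat by (simp add: field_simps)
  have 1: "qpoch a q (- int N) = qpoch a q m * (1 - a * q powi m)"
    using qpoch_plus_one[OF q(1) a(2), of m] unfolding m1 .
  have 2: "qpoch_inf (a * w * q powi m) q = (1 - a * w * q powi m) * qpoch_inf (a * w * q powi (- int N)) q"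
    using qpoch_inf_power_int_step[OF q, of "a * w" m] unfolding m1 .
  have 3: "w powi (- int N) = w powi m * w"
    using w(1) unfolding m1[symmetric] by (simp add: power_int_add)
  have key: "(1 - a * w * q powi m) * (1 - q / a * q ^ N) = (1 - a * q powi m) * w * (1 - q / (a * w) * q ^ N)"
    unfolding Q using a(1) w(1) q(1) by (simp add: field_simps)
  have "qpoch a q m * w powi m * qpoch_inf (a * w * q powi m) q * qpoch (q / a) q (int (Suc N))
      = qpoch a q m * w powi m * qpoch_inf (a * w * q powi (- int N)) q * qpoch (q / a) q (int N)
        * ((1 - a * w * q powi m) * (1 - q / a * q ^ N))"
    unfolding 2 qpoch_nat_Suc by (simp add: mult_ac)
  also have "\<dots> = (qpoch a q (- int N) * w powi (- int N) * qpoch_inf (a * w * q powi (- int N)) q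
        * qpoch (q / a) q (int N)) * (1 - q / (a * w) * q ^ N)"
    unfolding key 1 3 by (simp only: mult_ac)
  also have "\<dots> = qpoch (q / (a * w)) q (int (Suc N)) * qpoch_inf (a * w) q"
    unfolding Suc.IH qpoch_nat_Suc by (simp only: mult_ac)
  finally show ?case unfolding m_def .
qed simp

text \<open>
  The two evaluations of \<open>psi_sum (q ^ Suc N)\<close>, from \<open>psi_sum 0\<close> and from the \<open>q\<close>-binomial
  theorem, are compared for one \<open>N\<close> with \<open>q ^ Suc N\<close> inside the disc of convergence; the
  finite products of length \<open>N\<close> complete the tails \<open>(q ^ Suc N / x; q)_inf\<close>, so \<open>N\<close> drops out.
\<close>

lemma psi_sum_zero:
  "psi_sum 0 * (qpoch_inf (q / a) q * qpoch_inf w q)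
    = qpoch_inf q q * qpoch_inf (a * w) q * qpoch_inf (q / (a * w)) q"
proof -
  have "(\<lambda>N. norm (q * q ^ N)) \<longlonglongrightarrow> norm (0 :: complex)"
    by (intro tendsto_norm LIMSEQ_mult_power_0 q(2))
  then have "\<forall>\<^sub>F N in sequentially. norm (q * q ^ N) < norm (a * w)"
    by (rule order_tendstoD) (use a w in auto)
  then obtain N where N: "norm (q ^ Suc N) < norm (a * w)"
    by (auto simp: eventually_at_top_linorder)
  have tail: "qpoch_inf (q / x) q = qpoch (q / x) q (int N) * qpoch_inf (q ^ Suc N / x) q" for x
    using qpoch_inf_shift[OF q(2), of "q / x" N] by (simp add: qpoch_def)
  have "psi_sum 0 * (qpoch_inf (q / a) q * qpoch_inf w q)
      = qpoch (q / a) q (int N) * qpoch_inf w q * (qpoch_inf (q ^ Suc N / a) q * psi_sum 0)"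
    unfolding tail[of a] by (simp only: mult_ac)
  also have "\<dots> = qpoch (q / a) q (int N) * qpoch_inf (q ^ Suc N / (a * w)) q
      * (psi_sum (q ^ Suc N) * qpoch_inf w q)"
    unfolding psi_sum_eq_psi_sum_zero[OF N, symmetric] by (simp only: mult_ac)
  also have "\<dots> = qpoch_inf q q * qpoch_inf (q ^ Suc N / (a * w)) q *
      (qpoch a q (- int N) * w powi (- int N) * qpoch_inf (a * w * q powi (- int N)) q * qpoch (q / a) q (int N))"
    unfolding psi_sum_q_power[OF N] by (simp only: mult_ac)
  also have "\<dots> = qpoch_inf q q * qpoch_inf (a * w) q * qpoch_inf (q / (a * w)) q"
    unfolding qpoch_reflection_quotient tail[of "a * w"] by (simp only: mult_ac)
  finally show ?thesis .
qed

end

theorem ramanujan_1psi1: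
  assumes q: "q \<noteq> 0" "norm q < 1"
    and a: "a \<noteq> 0" "\<And>k::nat. k \<ge> 1 \<Longrightarrow> a \<noteq> q ^ k"
    and b: "\<And>k::int. b \<noteq> q powi k"
    and w: "norm (b / a) < norm w" "norm w < 1"
  shows "((\<lambda>m. qpoch a q m / qpoch b q m * w powi m) has_sum
      (qpochs_inf [q / (a * w), a * w, q, b / a] q / qpochs_inf [b, q / a, w, b / (a * w)] q)) UNIV"
proof -
  have w0: "w \<noteq> 0" using w(1) by auto
  have b_lt: "norm b < norm (a * w)"
    using w(1) a(1) by (simp add: norm_divide norm_mult field_simps)
  have nz_b: "qpoch_inf (b * q powi m) q \<noteq> 0" for m
  proof (rule qpoch_inf_nonzero[OF q(2)])
    fix k
    show "b * q powi m * q ^ k \<noteq> 1"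
    proof
      assume "b * q powi m * q ^ k = 1"
      then have "b * q powi (m + int k) = 1" using q(1) by (simp add: power_int_add mult_ac)
      then have "b = q powi (- (m + int k))"
        using q(1) by (simp add: power_int_minus field_simps del: minus_add_distrib)
      then show False using b by blast
    qed
  qed
  have nz_b0: "qpoch_inf b q \<noteq> 0" using nz_b[of 0] by simp
  have nz_w: "qpoch_inf w q \<noteq> 0" by (rule qpoch_inf_nonzero_of_norm_less_one[OF q(2) w(2)])
  have nz_baw: "qpoch_inf (b / (a * w)) q \<noteq> 0"
    by (rule qpoch_inf_nonzero_of_norm_less_one[OF q(2)])
      (use b_lt a(1) w0 in \<open>simp add: norm_divide norm_mult\<close>)
  have nz_a: "qpoch_inf (q / a) q \<noteq> 0"
    by (rule qpoch_inf_nonzero[OF q(2)]) (use a(2)[of "Suc _"] a(1) in \<open>auto simp: field_simps\<close>)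
  have term_eq: "psi_term a q w b m / qpoch_inf b q = qpoch a q m / qpoch b q m * w powi m" for m
    unfolding qpoch_eq_quotient[OF q nz_b] psi_term_def by (simp add: field_simps)
  have "psi_sum a q w 0 = qpoch_inf q q * qpoch_inf (a * w) q * qpoch_inf (q / (a * w)) q
      / (qpoch_inf (q / a) q * qpoch_inf w q)"
    using psi_sum_zero[OF q a w0 w(2)] nz_a nz_w by (simp add: field_simps)
  moreover have "psi_sum a q w b = qpoch_inf (b / a) q * psi_sum a q w 0 / qpoch_inf (b / (a * w)) q"
    using psi_sum_eq_psi_sum_zero[OF q a w0 w(2) b_lt] nz_baw by (simp add: field_simps)
  ultimately have "psi_sum a q w b / qpoch_inf b q
      = qpochs_inf [q / (a * w), a * w, q, b / a] q / qpochs_inf [b, q / a, w, b / (a * w)] q"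
    by (simp add: qpochs_inf_def mult_ac)
  moreover have "((\<lambda>m. psi_term a q w b m / qpoch_inf b q) has_sum (psi_sum a q w b / qpoch_inf b q)) UNIV"
    unfolding divide_inverse by (intro has_sum_cmult_left has_sum_psi_sum[OF q a w0 w(2) b_lt])
  ultimately show ?thesis unfolding term_eq by simp
qed

section \<open>Bilateral sums of basic hypergeometric series\<close>

theorem theorem3p1:
  fixes q z w :: complex and r s :: nat and \<alpha> \<beta> :: "nat \<Rightarrow> complex"
  assumes "0 < norm q" "norm q < 1"
    and "r \<ge> 1" "s \<ge> 1" "s \<le> r" "r \<le> s + 1"
    and "\<alpha> 1 \<noteq> 0"
    and "\<alpha> 1 \<notin> {q ^ k | k :: nat. k \<ge> 1}"
    and "\<beta> 1 \<notin> {q powi k | k :: int. True}"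
    and "\<And>j. j \<in> {2..s} \<Longrightarrow> \<beta> j \<notin> {q powi (- int k) | k :: nat. True}"
    and "norm (\<beta> 1 / \<alpha> 1) < norm w" "norm w < 1"
    and "r = s + 1 \<Longrightarrow> norm z < norm w"
  shows "((\<lambda>m :: int.
            qpoch (\<alpha> 1) q m / qpoch (\<beta> 1) q m
            * qhyp (\<alpha> 1 * q powi m # map \<alpha> [2..<r + 1]) (\<beta> 1 * q powi m # map \<beta> [2..<s + 1]) q z
            * w powi m)
          has_sum
            (qpochs_inf [q / (\<alpha> 1 * w), \<alpha> 1 * w, q, \<beta> 1 / \<alpha> 1] q
             / qpochs_inf [\<beta> 1, q / \<alpha> 1, w, \<beta> 1 / (\<alpha> 1 * w)] q
             * qhyp (map \<alpha> [2..<r + 1]) (map \<beta> [2..<s + 1]) q (z / w))) UNIV"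
proof -
  define as where "as = map \<alpha> [2..<r + 1]"
  define bs where "bs = map \<beta> [2..<s + 1]"
  have len: "int (length bs) + 1 - int (length as) = int s + 1 - int r"
    using assms(3,4) by (simp add: as_def bs_def)
  have q: "q \<noteq> 0" "norm q < 1" using assms(1,2) by auto
  have w0: "w \<noteq> 0" using assms(11) by auto
  have a: "\<alpha> 1 \<noteq> q ^ k" if "k \<ge> 1" for k using assms(8) that by blast
  have b: "\<beta> 1 \<noteq> q powi k" for k using assms(9) by blast
  have b': "\<beta> 1 \<noteq> q ^ k" for k using b[of "int k"] by simp
  define A where "A m = qpoch (\<alpha> 1) q m / qpoch (\<beta> 1) q m * w powi m" for m
  define c where "c n = qpochs as q (int n) / qpochs (q # bs) q (int n)
      * ((-1) ^ n * q ^ (n * (n - 1) div 2)) powi (int s + 1 - int r) * (z / w) ^ n" for n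
  have c_sum: "suminf c = qhyp as bs q (z / w)"
    unfolding qhyp_def len c_def ..
  have len_le: "length as \<le> length bs + 1" "length as = length bs + 1 \<Longrightarrow> r = s + 1"
    using len assms(6) by linarith+
  have "summable (\<lambda>n. norm (c n))"
    unfolding c_def len[symmetric] using len_le(1)
  proof (rule summable_norm_qhyp_terms[OF q(2)])
    assume "length as = length bs + 1"
    then show "norm (z / w) < 1" using len_le(2) assms(13) w0 by (simp add: norm_divide)
  qed
  moreover have "(A has_sum (qpochs_inf [q / (\<alpha> 1 * w), \<alpha> 1 * w, q, \<beta> 1 / \<alpha> 1] q
             / qpochs_inf [\<beta> 1, q / \<alpha> 1, w, \<beta> 1 / (\<alpha> 1 * w)] q)) UNIV"
    unfolding A_def by (rule ramanujan_1psi1[OF q assms(7) a b assms(11,12)])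
  ultimately have "((\<lambda>m. \<Sum>n. A (m + int n) * c n) has_sum
       (qpochs_inf [q / (\<alpha> 1 * w), \<alpha> 1 * w, q, \<beta> 1 / \<alpha> 1] q
             / qpochs_inf [\<beta> 1, q / \<alpha> 1, w, \<beta> 1 / (\<alpha> 1 * w)] q * suminf c)) UNIV"
    by (intro has_sum_bilateral_convolution)
  moreover have "(\<Sum>n. A (m + int n) * c n) = qpoch (\<alpha> 1) q m / qpoch (\<beta> 1) q m
      * qhyp (\<alpha> 1 * q powi m # as) (\<beta> 1 * q powi m # bs) q z * w powi m" for m
  proof -
    have len_m: "int (length (\<beta> 1 * q powi m # bs)) + 1 - int (length (\<alpha> 1 * q powi m # as))
        = int s + 1 - int r"
      using len by simp
    define t where "t n = qpochs (\<alpha> 1 * q powi m # as) q (int n)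
        / qpochs (q # \<beta> 1 * q powi m # bs) q (int n)
        * ((-1) ^ n * q ^ (n * (n - 1) div 2)) powi (int s + 1 - int r) * z ^ n" for n
    have t_sum: "suminf t = qhyp (\<alpha> 1 * q powi m # as) (\<beta> 1 * q powi m # bs) q z"
      unfolding qhyp_def len_m t_def ..
    have wz: "w powi (m + int n) * (z / w) ^ n = w powi m * z ^ n" for n
      using w0 by (simp add: power_int_add power_divide)
    have "A (m + int n) * c n = A m * t n" for n
    proof -
      have A_shift: "A (m + int n) = qpoch (\<alpha> 1) q m / qpoch (\<beta> 1) q m
          * (qpoch (\<alpha> 1 * q powi m) q (int n) / qpoch (\<beta> 1 * q powi m) q (int n)) * w powi (m + int n)"
        unfolding A_def by (simp only: qpoch_add[OF q(1) a] qpoch_add[OF q(1) b'] times_divide_times_eq)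
      have "X * Y * w powi (m + int n) * (C * D * (z / w) ^ n) = X * w powi m * (Y * C * D * z ^ n)" for X Y C D
        using wz[of n] by (metis (no_types, lifting) mult.assoc mult.commute)
      then show ?thesis unfolding A_shift c_def unfolding A_def t_def qpochs_quotient_Cons .
    qed
    moreover have "summable t"
      unfolding t_def len_m[symmetric]
    proof (rule summable_norm_cancel, rule summable_norm_qhyp_terms[OF q(2)])
      show "length (\<alpha> 1 * q powi m # as) \<le> length (\<beta> 1 * q powi m # bs) + 1"
        using len_le(1) by simp
      assume "length (\<alpha> 1 * q powi m # as) = length (\<beta> 1 * q powi m # bs) + 1"
      then show "norm z < 1" using len_le(2) assms(12,13) by simp
    qed
    ultimately have "(\<Sum>n. A (m + int n) * c n) = A m * suminf t"
      by (simp only: suminf_mult)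
    also have "\<dots> = qpoch (\<alpha> 1) q m / qpoch (\<beta> 1) q m * suminf t * w powi m"
      unfolding A_def by (simp only: mult_ac)
    finally show ?thesis unfolding t_sum .
  qed
  ultimately show ?thesis unfolding c_sum as_def bs_def by simp
qed

end
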